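(* For every integer $k\ge1$, $$E^{k(k-1)\cdots1}_{3\text{-}21}(x)=\begin{cases}0,&\text{if }k\ge3,\\[1mm] e^{e^x}\displaystyle\int_0^x e^{-e^t}(e^t-1)\,dt,&\text{if }k=2,\\[2mm] e^{e^x-1},&\text{if }k=1.\end{cases}$$
   Context: A permutation $\pi=\pi_1\cdots\pi_n$ of $\{1,\dots,n\}$ contains the generalized pattern $3\text{-}21$ if there are indices $i<j<n$ such that $\pi_i\pi_j\pi_{j+1}$ is order-isomorphic to $321$; otherwise it avoids it. A permutation $\pi$ begins with a pattern $p=p_1\cdots p_k$ if $n\ge k$ and $\pi_1\cdots\pi_k$ is order-isomorphic to $p$; by convention, the empty permutation is also regarded as beginning with the pattern $1$ (the case $k=1$). $E^p_q(x)=\sum_{n\ge0}N^p_q(n)\frac{x^n}{n!}$, where $N^p_q(n)$ is the number of permutations of $\{1,\dots,n\}$ that avoid $q$ and begin with $p$. Identities are identities of power series in $x$. *)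

theory Defs
  imports
    "HOL-Analysis.Analysis"
    "HOL-Combinatorics.Multiset_Permutations"
begin

text \<open>
  A permutation of \<open>{1..n}\<close> is represented by its one-line notation, an element of
  \<open>permutations_of_set {1..n}\<close>. List positions are counted from 0.
\<close>

definition order_isomorphic :: "nat list \<Rightarrow> nat list \<Rightarrow> bool" where
  "order_isomorphic u v \<longleftrightarrow>
     length u = length v \<and>
     (\<forall>i<length u. \<forall>j<length u. u ! i < u ! j \<longleftrightarrow> v ! i < v ! j)"

definition contains_3_21 :: "nat list \<Rightarrow> bool" where
  "contains_3_21 w \<longleftrightarrow>
     (\<exists>i j. i < j \<and> j + 1 < length w \<and>
            order_isomorphic [w ! i, w ! j, w ! (j + 1)] [3, 2, 1])"

text \<open>The second disjunct is the convention that the empty permutation begins with the pattern 1.\<close>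

definition begins_with :: "nat list \<Rightarrow> nat list \<Rightarrow> bool" where
  "begins_with w p \<longleftrightarrow>
     (length p \<le> length w \<and> order_isomorphic (take (length p) w) p) \<or>
     (w = [] \<and> p = [1])"

definition N_3_21 :: "nat list \<Rightarrow> nat \<Rightarrow> nat" where
  "N_3_21 p n =
     card {w \<in> permutations_of_set {1..n}. \<not> contains_3_21 w \<and> begins_with w p}"

definition E_3_21 :: "nat list \<Rightarrow> real fps" where
  "E_3_21 p = Abs_fps (\<lambda>n. real (N_3_21 p n) / fact n)"

definition decreasing_pattern :: "nat \<Rightarrow> nat list" where
  "decreasing_pattern k = rev [1..<k + 1]"

end

theory Submission
  imports Defs
begin

text \<open>
  The letters after the maximal letter of a permutation avoiding 3-21 must increase, and the
  letters before it form an arbitrary avoider. Choosing the set of letters before it gives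
  \<open>N (n + 1) = (\<Sum>k\<le>n. (n choose k) * N k) + d n\<close>, where \<open>d n\<close> counts the permutation that starts
  with its maximal letter if it begins with \<open>p\<close> although its empty prefix does not. Hence the
  generating function satisfies \<open>E' = exp x * E + (1 - E 0) * (exp x - 1)\<close>, and it converges on
  the unit interval because \<open>N n \<le> n!\<close>, so the equation can be solved analytically there.
\<close>

section \<open>The patterns in terms of the letters of a word\<close>

lemma contains_3_21_iff:
  "contains_3_21 w \<longleftrightarrow>
     (\<exists>i j. i < j \<and> Suc j < length w \<and> w ! Suc j < w ! j \<and> w ! j < w ! i)"
proof -
  have "order_isomorphic [a, b, c] [3, 2, 1] \<longleftrightarrow> c < b \<and> b < a" for a b c
    by (auto simp: order_isomorphic_def numeral_3_eq_3 All_less_Suc)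
  then show ?thesis
    by (simp add: contains_3_21_def)
qed

lemma begins_with_1: "begins_with w [1]"
  by (cases w) (auto simp: begins_with_def order_isomorphic_def)

lemma begins_with_21_iff: "begins_with w [2, 1] \<longleftrightarrow> 2 \<le> length w \<and> w ! 1 < w ! 0"
proof (cases "2 \<le> length w")
  case True
  then obtain a b v where "w = a # b # v"
    by (metis Suc_le_length_iff numeral_2_eq_2)
  then show ?thesis
    by (auto simp: begins_with_def order_isomorphic_def All_less_Suc numeral_2_eq_2)
qed (auto simp: begins_with_def)

text \<open>The first three letters already form a 321 whose last two letters are adjacent; hence
  all counts vanish for \<open>k \<ge> 3\<close>.\<close>

lemma begins_with_decreasing_contains_3_21:
  assumes "3 \<le> k" and "begins_with w (decreasing_pattern k)"
  shows "contains_3_21 w"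
proof -
  have len: "length (decreasing_pattern k) = k"
    by (simp add: decreasing_pattern_def)
  have nth: "decreasing_pattern k ! i = k - i" if "i < k" for i
    using that by (simp add: decreasing_pattern_def rev_nth del: upt_Suc)
  \<comment> \<open>This excludes the convention on the empty permutation, leaving the genuine
    prefix condition.\<close>
  have "decreasing_pattern k \<noteq> [1]"
    using len assms(1) by auto
  with assms(2) have k: "k \<le> length w"
    and iso: "\<And>i j. i < k \<Longrightarrow> j < k \<Longrightarrow> w ! i < w ! j \<longleftrightarrow> k - i < k - j"
    using len by (auto simp: begins_with_def order_isomorphic_def nth)
  have "w ! 2 < w ! 1" "w ! 1 < w ! 0"
    using iso[of 2 1] iso[of 1 0] assms(1) by auto
  then show ?thesis
    using k assms(1) unfolding contains_3_21_iff
    by (intro exI[of _ 0] exI[of _ 1]) (auto simp: numeral_2_eq_2)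
qed

section \<open>Splitting a permutation at its maximal letter\<close>

lemma contains_3_21_append_max_iff:
  assumes less: "\<forall>a\<in>set (u @ v). a < m"
  shows "contains_3_21 (u @ m # v) \<longleftrightarrow> contains_3_21 u \<or> \<not> sorted v"
proof
  assume "contains_3_21 (u @ m # v)"
  then obtain i j where ij: "i < j" "Suc j < length (u @ m # v)"
    "(u @ m # v) ! Suc j < (u @ m # v) ! j" "(u @ m # v) ! j < (u @ m # v) ! i"
    unfolding contains_3_21_iff by blast
  \<comment> \<open>The cases locate the adjacent pair relative to \<open>m\<close>. A pair ending
    at \<open>m\<close> ascends, and \<open>m\<close> cannot play the 2 because no earlier letter
    exceeds it. So the descent lies wholly in \<open>u\<close>, together with \<open>i\<close>, or
    wholly in \<open>v\<close>.\<close>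
  consider "Suc j < length u" | "Suc j = length u" | "j = length u" | "length u < j"
    by linarith
  then show "contains_3_21 u \<or> \<not> sorted v"
  proof cases
    case 1
    then show ?thesis
      using ij unfolding contains_3_21_iff
      by (intro disjI1 exI[of _ i] exI[of _ j]) (auto simp: nth_append)
  next
    case 2
    then have "u ! j < m"
      using less by auto
    then show ?thesis
      using 2 ij(3) by (auto simp: nth_append)
  next
    case 3
    have "(u @ m # v) ! i \<in> set u"
      using 3 ij(1) by (auto simp: nth_append)
    then have "(u @ m # v) ! i < m"
      using less by auto
    then show ?thesis
      using 3 ij(4) by simp
  next
    case 4
    then obtain l where l: "j = length u + Suc l"
      using less_imp_Suc_add by fastforce
    have "Suc l < length v" "v ! Suc l < v ! l"
      using ij(2,3) l by (auto simp: nth_append)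
    then show ?thesis
      by (auto simp: sorted_iff_nth_Suc not_le)
  qed
next
  assume "contains_3_21 u \<or> \<not> sorted v"
  then show "contains_3_21 (u @ m # v)"
  proof
    assume "contains_3_21 u"
    then obtain i j where "i < j" "Suc j < length u" "u ! Suc j < u ! j" "u ! j < u ! i"
      unfolding contains_3_21_iff by blast
    then show ?thesis
      unfolding contains_3_21_iff
      by (intro exI[of _ i] exI[of _ j]) (auto simp: nth_append)
  next
    assume "\<not> sorted v"
    then obtain l where l: "Suc l < length v" "v ! Suc l < v ! l"
      by (auto simp: sorted_iff_nth_Suc not_le)
    moreover have "v ! l < m"
      using l(1) less by auto
    \<comment> \<open>\<open>m\<close> plays the 3 in front of the descent of
      \<open>v\<close>.\<close>
    ultimately show ?thesis
      unfolding contains_3_21_iff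
      by (intro exI[of _ "length u"] exI[of _ "length u + Suc l"]) (auto simp: nth_append)
  qed
qed

text \<open>General letter sets are allowed because the letters before the maximum can be any subset
  of the others.\<close>

definition avoiders :: "nat list \<Rightarrow> nat set \<Rightarrow> nat list set" where
  "avoiders p A = {w \<in> permutations_of_set A. \<not> contains_3_21 w \<and> begins_with w p}"

lemma N_3_21_eq_card_avoiders: "N_3_21 p n = card (avoiders p {1..n})"
  by (simp add: N_3_21_def avoiders_def)

lemma finite_avoiders: "finite (avoiders p A)"
  by (simp add: avoiders_def)

text \<open>
  This covers both patterns \<open>1\<close> and \<open>21\<close>: the exceptional disjunct is the case in which
  the maximal letter comes first.
\<close>

definition splits_at_max :: "nat list \<Rightarrow> bool" where
  "splits_at_max p \<longleftrightarrow>
     (\<forall>u v m. (\<forall>a\<in>set (u @ v). a < m) \<longrightarrow>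
        begins_with (u @ m # v) p \<longleftrightarrow> begins_with u p \<or> u = [] \<and> v \<noteq> [])"

lemma splits_at_max_1: "splits_at_max [1]"
  unfolding splits_at_max_def by (simp only: begins_with_1) simp

lemma splits_at_max_21: "splits_at_max [2, 1]"
  unfolding splits_at_max_def
proof (intro allI impI)
  fix u v :: "nat list" and m :: nat
  assume less: "\<forall>a\<in>set (u @ v). a < m"
  \<comment> \<open>Only the first two letters decide, so \<open>m\<close> matters only if
    \<open>u\<close> has at most one letter: in first place it makes a descent with any next letter,
    in second place an ascent.\<close>
  consider "u = []" | a where "u = [a]" | a b u' where "u = a # b # u'"
    by (metis list.exhaust)
  then show "begins_with (u @ m # v) [2, 1] \<longleftrightarrow> begins_with u [2, 1] \<or> u = [] \<and> v \<noteq> []"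
  proof cases
    case 1
    then show ?thesis
      using less by (cases v) (auto simp: begins_with_21_iff[simplified])
  next
    case 2
    then show ?thesis
      using less by (auto simp: begins_with_21_iff[simplified])
  next
    case 3
    then show ?thesis
      by (auto simp: begins_with_21_iff[simplified])
  qed
qed

lemma not_contains_3_21_Nil: "\<not> contains_3_21 []"
  by (simp add: contains_3_21_iff)

lemma avoiders_insert_max:
  assumes p: "splits_at_max p" and fin: "finite A" and less: "\<forall>a\<in>A. a < m"
  shows "avoiders p (insert m A) =
           (\<Union>S\<in>Pow A. (\<lambda>u. u @ m # sorted_list_of_set (A - S)) `
              (avoiders p S \<union> (if S = {} \<and> A \<noteq> {} then {[]} else {})))" (is "_ = ?R")
proof (intro set_eqI iffI)
  fix w assume "w \<in> avoiders p (insert m A)"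
  then have w: "set w = insert m A" "distinct w" "\<not> contains_3_21 w" "begins_with w p"
    by (auto simp: avoiders_def permutations_of_set_def)
  then obtain u v where uv: "w = u @ m # v"
    by (metis insertI1 split_list)
  have m: "m \<notin> A"
    using less by blast
  have A: "A = set u \<union> set v" "set u \<inter> set v = {}" "distinct u" "distinct v"
    using w(1,2) m unfolding uv by auto
  have less': "\<forall>a\<in>set (u @ v). a < m"
    using less A by auto
  have "sorted v" "\<not> contains_3_21 u"
    using w(3) contains_3_21_append_max_iff[OF less'] uv by auto
  moreover have "A - set u = set v"
    using A by auto
  ultimately have "sorted_list_of_set (A - set u) = v"
    using A(4) sorted_list_of_set.idem_if_sorted_distinct by metis
  moreover have "begins_with u p \<or> u = [] \<and> v \<noteq> []"
    using p w(4) less' unfolding splits_at_max_def uv by blast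
  moreover have "u \<in> permutations_of_set (set u)"
    using A(3) by auto
  ultimately show "w \<in> ?R"
    using \<open>\<not> contains_3_21 u\<close> A(1) uv
    by (intro UN_I[of "set u"]) (auto simp: avoiders_def)
next
  fix w assume "w \<in> ?R"
  then obtain S u where S: "S \<subseteq> A" and w: "w = u @ m # sorted_list_of_set (A - S)"
    and "u \<in> avoiders p S \<union> (if S = {} \<and> A \<noteq> {} then {[]} else {})"
    by blast
  then have u: "u \<in> avoiders p S \<or> S = {} \<and> A \<noteq> {} \<and> u = []"
    by (auto split: if_splits)
  have setu: "set u = S" "distinct u" "\<not> contains_3_21 u" "begins_with u p \<or> u = [] \<and> A - S \<noteq> {}"
    using u by (auto simp: avoiders_def permutations_of_set_def not_contains_3_21_Nil)
  have less': "\<forall>a\<in>set (u @ sorted_list_of_set (A - S)). a < m"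
    using less S setu fin by auto
  have "w \<in> permutations_of_set (insert m A)"
    using setu S fin less unfolding w by (intro permutations_of_setI) auto
  moreover have "\<not> contains_3_21 w"
    using contains_3_21_append_max_iff[OF less'] setu(3) unfolding w by simp
  moreover have "begins_with w p"
    using p less' setu(4) fin unfolding splits_at_max_def w by (metis sorted_list_of_set_eq_Nil_iff finite_Diff)
  ultimately show "w \<in> avoiders p (insert m A)"
    by (simp add: avoiders_def)
qed

text \<open>The pieces of the decomposition are disjoint and parametrized injectively: a word
  determines the prefix before \<open>m\<close>, and the prefix determines \<open>S\<close>.\<close>

lemma card_avoiders_insert_max:
  assumes p: "splits_at_max p" and fin: "finite A" and less: "\<forall>a\<in>A. a < m"
  shows "card (avoiders p (insert m A)) =
           (\<Sum>S\<in>Pow A. card (avoiders p S)) + (if A \<noteq> {} \<and> \<not> begins_with [] p then 1 else 0)"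
proof -
  define B where "B S = avoiders p S \<union> (if S = {} \<and> A \<noteq> {} then {[]} else {})" for S
  have setB: "set u = S" if "u \<in> B S" for u S
    using that by (auto simp: B_def avoiders_def permutations_of_set_def split: if_splits)
  have finB: "finite (B S)" for S
    by (simp add: B_def finite_avoiders)
  have B_eq: "S = S' \<and> u = u'"
    if "S \<subseteq> A" "S' \<subseteq> A" "u \<in> B S" "u' \<in> B S'"
       "u @ m # sorted_list_of_set (A - S) = u' @ m # sorted_list_of_set (A - S')" for S S' u u'
  proof -
    have "m \<notin> set u" "m \<notin> set u'"
      using that setB less by blast+
    then have "u = u'"
      using that less fin
        by (subst (asm) append_Cons_eq_iff) auto
    then show ?thesis
      using setB that by metis
  qed
  have "card (avoiders p (insert m A)) =
          (\<Sum>S\<in>Pow A. card ((\<lambda>u. u @ m # sorted_list_of_set (A - S)) ` B S))"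
    unfolding avoiders_insert_max[OF p fin less] B_def[symmetric]
  proof (rule card_UN_disjoint)
    show "\<forall>S\<in>Pow A. \<forall>S'\<in>Pow A. S \<noteq> S' \<longrightarrow>
      (\<lambda>u. u @ m # sorted_list_of_set (A - S)) ` B S \<inter>
      (\<lambda>u. u @ m # sorted_list_of_set (A - S')) ` B S' = {}"
      using B_eq by blast
  qed (use fin finB in auto)
  also have "\<dots> = (\<Sum>S\<in>Pow A. card (B S))"
    by (intro sum.cong refl card_image inj_onI) auto
  \<comment> \<open>For \<open>S = {}\<close> the extra \<open>[]\<close> adds an element only if it
    is not yet in \<open>avoiders p {}\<close>, that is, if \<open>[]\<close> does not begin with
    \<open>p\<close>.\<close>
  also have "\<dots> = (\<Sum>S\<in>Pow A. card (avoiders p S) +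
      (if S = {} then if A \<noteq> {} \<and> \<not> begins_with [] p then 1 else 0 else 0))"
    by (intro sum.cong refl)
       (auto simp: B_def avoiders_def not_contains_3_21_Nil insert_absorb)
  also have "\<dots> = (\<Sum>S\<in>Pow A. card (avoiders p S)) + (if A \<noteq> {} \<and> \<not> begins_with [] p then 1 else 0)"
    using fin by (subst sum.distrib) (simp add: sum.delta)
  finally show ?thesis .
qed

section \<open>Recurrence for the number of avoiders\<close>

lemma sum_Pow_card:
  fixes f :: "nat \<Rightarrow> nat"
  assumes "finite A"
  shows "(\<Sum>S\<in>Pow A. f (card S)) = (\<Sum>k\<le>card A. (card A choose k) * f k)"
proof -
  have "(\<Sum>S\<in>Pow A. f (card S)) = (\<Sum>k\<le>card A. \<Sum>S\<in>{S \<in> Pow A. card S = k}. f (card S))"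
    using assms by (intro sum.group[symmetric]) (auto intro: card_mono)
  also have "\<dots> = (\<Sum>k\<le>card A. (card A choose k) * f k)"
    using n_subsets[OF assms] by (intro sum.cong refl) (simp add: Pow_def)
  finally show ?thesis .
qed

text \<open>Strong induction on the size replaces a relabelling of letters: removing the maximum
  gives \<open>A\<close> and \<open>{1..card A}\<close> the same recurrence, which involves only
  smaller sets.\<close>

lemma card_avoiders:
  assumes p: "splits_at_max p" and "finite A"
  shows "card (avoiders p A) = N_3_21 p (card A)"
  using \<open>finite A\<close>
proof (induction "card A" arbitrary: A rule: less_induct)
  case less
  show ?case
  proof (cases "A = {}")
    case True
    then show ?thesis
      by (simp add: N_3_21_eq_card_avoiders)
  next
    case False
    have step: "card (avoiders p (insert m B)) =
        (\<Sum>k\<le>card B. (card B choose k) * N_3_21 p k) +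
        (if card B \<noteq> 0 \<and> \<not> begins_with [] p then 1 else 0)"
      if B: "finite B" "\<forall>b\<in>B. b < m" "card B < card A" for m B
    proof -
      have "(\<Sum>S\<in>Pow B. card (avoiders p S)) = (\<Sum>S\<in>Pow B. N_3_21 p (card S))"
        using B by (intro sum.cong refl less.hyps)
          (auto intro: finite_subset le_less_trans[OF card_mono])
      then show ?thesis
        using card_avoiders_insert_max[OF p B(1,2)] B(1) by (simp add: sum_Pow_card)
    qed
    define m B n where "m = Max A" and "B = A - {m}" and "n = card B"
    have "m \<in> A" "\<forall>a\<in>A. a \<le> m"
      using less.prems False by (simp_all add: m_def)
    then have A: "A = insert m B" "finite B" "m \<notin> B" "\<forall>b\<in>B. b < m"
      using less.prems by (auto simp: B_def order_less_le)
    have cA: "card A = Suc n"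
      using A by (simp add: n_def)
    have "{1..Suc n} = insert (Suc n) {1..n}"
      by auto
    then show ?thesis
      using step[of B m] step[of "{1..n}" "Suc n"] A cA
      by (simp add: N_3_21_eq_card_avoiders n_def)
  qed
qed

lemma N_3_21_Suc:
  assumes p: "splits_at_max p"
  shows "N_3_21 p (Suc n) = (\<Sum>k\<le>n. (n choose k) * N_3_21 p k) +
           (if n \<noteq> 0 \<and> \<not> begins_with [] p then 1 else 0)"
proof -
  have "(\<Sum>S\<in>Pow {1..n}. card (avoiders p S)) = (\<Sum>S\<in>Pow {1..n}. N_3_21 p (card S))"
    by (intro sum.cong refl card_avoiders[OF p]) (auto intro: finite_subset)
  moreover have "{1..Suc n} = insert (Suc n) {1..n}"
    by auto
  ultimately show ?thesis
    using card_avoiders_insert_max[OF p, of "{1..n}" "Suc n"]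
    by (simp add: N_3_21_eq_card_avoiders[of _ "Suc n"] sum_Pow_card)
qed

lemma N_3_21_0: "N_3_21 p 0 = (if begins_with [] p then 1 else 0)"
proof -
  have "avoiders p {} = (if begins_with [] p then {[]} else {})"
    by (auto simp: avoiders_def not_contains_3_21_Nil)
  then show ?thesis
    by (simp add: N_3_21_eq_card_avoiders)
qed

lemma N_3_21_le_fact: "N_3_21 p n \<le> fact n"
proof -
  have "N_3_21 p n \<le> card (permutations_of_set {1..n})"
    unfolding N_3_21_def by (intro card_mono) auto
  then show ?thesis
    by simp
qed

section \<open>Differential equation of the generating function\<close>

lemma fps_deriv_E_3_21:
  assumes p: "splits_at_max p"
  shows "fps_deriv (E_3_21 p) =
           fps_exp 1 * E_3_21 p + fps_const (1 - fps_nth (E_3_21 p) 0) * (fps_exp 1 - 1)"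
proof (rule fps_ext)
  fix n
  have "fps_nth (fps_deriv (E_3_21 p)) n = real (N_3_21 p (Suc n)) / fact n"
    by (simp add: E_3_21_def field_simps del: of_nat_Suc)
  also have "real (N_3_21 p (Suc n)) / fact n =
      (\<Sum>k\<le>n. real (n choose k) * N_3_21 p k / fact n) +
      (if n \<noteq> 0 \<and> \<not> begins_with [] p then 1 else 0) / fact n"
    by (simp add: N_3_21_Suc[OF p] add_divide_distrib sum_divide_distrib)
  \<comment> \<open>Division by \<open>fact n\<close> turns the binomial convolution into a Cauchy
    product with the exponential series.\<close>
  also have "(\<Sum>k\<le>n. real (n choose k) * N_3_21 p k / fact n) = fps_nth (E_3_21 p * fps_exp 1) n"
    unfolding fps_mult_nth atLeast0AtMost
    by (intro sum.cong refl) (simp add: E_3_21_def binomial_fact)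
  \<comment> \<open>The constant term of \<open>E_3_21 p\<close> is 1 or 0 according to whether
    \<open>[]\<close> begins with \<open>p\<close>; subtracting 1 from \<open>fps_exp 1\<close>
    removes the case \<open>n = 0\<close>.\<close>
  also have "(if n \<noteq> 0 \<and> \<not> begins_with [] p then 1 else 0) / fact n =
      fps_nth (fps_const (1 - fps_nth (E_3_21 p) 0) * (fps_exp 1 - 1)) n"
    by (simp add: E_3_21_def N_3_21_0)
  finally show "fps_nth (fps_deriv (E_3_21 p)) n =
      fps_nth (fps_exp 1 * E_3_21 p + fps_const (1 - fps_nth (E_3_21 p) 0) * (fps_exp 1 - 1)) n"
    by (simp add: mult.commute)
qed

section \<open>Analytic solution on the unit interval\<close>

lemma fps_conv_radius_ge_1:
  fixes F :: "real fps"
  assumes "\<And>n. \<bar>fps_nth F n\<bar> \<le> 1"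
  shows "fps_conv_radius F \<ge> 1"
  unfolding fps_conv_radius_def
proof (rule conv_radius_geI_ex)
  fix r :: real assume r: "0 < r" "ereal r < 1"
  have "summable (\<lambda>n. fps_nth F n * r ^ n)"
  proof (rule summable_comparison_test')
    show "summable (\<lambda>n. r ^ n)"
      using r by (intro summable_geometric) simp
    show "norm (fps_nth F n * r ^ n) \<le> r ^ n" if "n \<ge> 0" for n
      using assms[of n] r by (simp add: abs_mult mult_left_le_one_le)
  qed
  then show "\<exists>z. norm z = r \<and> summable (\<lambda>n. fps_nth F n * z ^ n)"
    using r by (intro exI[of _ r]) simp
qed

text \<open>\<open>exp (- exp x)\<close> is the integrating factor of the linear differential equation.\<close>

lemma has_fps_expansion_linear_ode:
  fixes F :: "real fps"
  assumes bound: "\<And>n. \<bar>fps_nth F n\<bar> \<le> 1"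
    and ode: "fps_deriv F = fps_exp 1 * F + fps_const c * (fps_exp 1 - 1)"
  shows "(\<lambda>x. exp (exp x) *
            (fps_nth F 0 * exp (- 1) + c * (LBINT t=0..ereal x. exp (- exp t) * (exp t - 1))))
           has_fps_expansion F"
proof -
  have rad: "fps_conv_radius F \<ge> 1"
    by (rule fps_conv_radius_ge_1) fact
  have deriv: "(eval_fps F has_field_derivative exp y * eval_fps F y + c * (exp y - 1)) (at y within S)"
    if "\<bar>y\<bar> < 1" for y S
  proof -
    have y: "ereal (norm y) < fps_conv_radius F"
      using that by (intro less_le_trans[OF _ rad]) simp
    \<comment> \<open>The exponential factors converge everywhere, so each product in the formal
      equation can be evaluated at \<open>y\<close>.\<close>
    have *: "fps_conv_radius (fps_exp 1 - 1 :: real fps) = \<infinity>"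
      using fps_conv_radius_diff[of "fps_exp 1" "1 :: real fps"] by simp
    have "eval_fps (fps_deriv F) y = exp y * eval_fps F y + c * (exp y - 1)"
      using y fps_conv_radius_mult[of "fps_exp 1" F] 
        fps_conv_radius_mult[of "fps_const c" "fps_exp 1 - 1 :: real fps"] *
      unfolding ode
      by (subst eval_fps_add eval_fps_mult eval_fps_diff; simp)+
    then show ?thesis
      using has_field_derivative_eval_fps[OF y, of S] by simp
  qed
  have eq: "exp (exp x) * (fps_nth F 0 * exp (- 1) + c * (LBINT t=0..ereal x. exp (- exp t) * (exp t - 1)))
      = eval_fps F x" if x: "\<bar>x\<bar> < 1" for x
  proof -
    \<comment> \<open>Differentiating \<open>exp (- exp t) * eval_fps F t\<close> cancels the term
      \<open>exp t * eval_fps F t\<close> of the equation and leaves the integrand. Below,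
      \<open>min\<close> and \<open>max\<close> cover negative \<open>x\<close>.\<close>
    have "(LBINT t=ereal 0..ereal x. c * (exp (- exp t) * (exp t - 1))) =
        exp (- exp x) * eval_fps F x - exp (- exp 0) * eval_fps F 0"
    proof (rule interval_integral_FTC_finite)
      show "continuous_on {min 0 x..max 0 x} (\<lambda>t. c * (exp (- exp t) * (exp t - 1)))"
        by (intro continuous_intros)
    next
      fix y assume "min 0 x \<le> y" "y \<le> max 0 x"
      then have "\<bar>y\<bar> < 1"
        using x by auto
      then show "((\<lambda>t. exp (- exp t) * eval_fps F t) has_vector_derivative
          c * (exp (- exp y) * (exp y - 1))) (at y within {min 0 x..max 0 x})"
        unfolding has_real_derivative_iff_has_vector_derivative[symmetric]
        by (auto intro!: derivative_eq_intros deriv simp: algebra_simps)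
    qed
    then have "c * (LBINT t=0..ereal x. exp (- exp t) * (exp t - 1)) =
        exp (- exp x) * eval_fps F x - exp (- 1) * fps_nth F 0"
      by (simp add: eval_fps_at_0 zero_ereal_def)
    then show ?thesis
      by (simp add: algebra_simps flip: exp_add)
  qed
  \<comment> \<open>An expansion needs a positive radius and agreement near 0 only.\<close>
  have "eventually (\<lambda>x. x \<in> ball 0 1) (nhds (0::real))"
    by (intro eventually_nhds_in_open) auto
  then show ?thesis
    unfolding has_fps_expansion_def using less_le_trans[of 0 1 "fps_conv_radius F"] rad eq
    by (auto elim!: eventually_mono)
qed

text \<open>Counts are at most \<open>fact n\<close>, which gives the coefficient bound needed to
  solve the equation.\<close>

lemma E_3_21_has_fps_expansion:
  assumes "splits_at_max p"
  shows "(\<lambda>x. exp (exp x) * (fps_nth (E_3_21 p) 0 * exp (- 1) +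
            (1 - fps_nth (E_3_21 p) 0) * (LBINT t=0..ereal x. exp (- exp t) * (exp t - 1))))
           has_fps_expansion E_3_21 p"
proof (rule has_fps_expansion_linear_ode)
  show "\<bar>fps_nth (E_3_21 p) n\<bar> \<le> 1" for n
    using N_3_21_le_fact[of p n] of_nat_mono[of "N_3_21 p n" "fact n", where 'a = real]
    by (simp add: E_3_21_def)
  show "fps_deriv (E_3_21 p) =
      fps_exp 1 * E_3_21 p + fps_const (1 - fps_nth (E_3_21 p) 0) * (fps_exp 1 - 1)"
    by (rule fps_deriv_E_3_21) fact
qed

theorem proposition6:
  fixes k :: nat
  assumes "k \<ge> 1"
  shows "(k \<ge> 3 \<longrightarrow> E_3_21 (decreasing_pattern k) = 0) \<and>
         (k = 2 \<longrightarrow>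
            (\<lambda>x::real. exp (exp x) * (LBINT t=0..ereal x. exp (- exp t) * (exp t - 1)))
              has_fps_expansion E_3_21 (decreasing_pattern k)) \<and>
         (k = 1 \<longrightarrow>
            (\<lambda>x::real. exp (exp x - 1)) has_fps_expansion E_3_21 (decreasing_pattern k))"
proof (intro conjI impI)
  assume "k \<ge> 3"
  then have "N_3_21 (decreasing_pattern k) n = 0" for n
    using begins_with_decreasing_contains_3_21 by (auto simp: N_3_21_def)
  then show "E_3_21 (decreasing_pattern k) = 0"
    by (simp add: E_3_21_def fps_eq_iff)
next
  assume "k = 2"
  then have k: "decreasing_pattern k = [2, 1]"
    by (simp add: decreasing_pattern_def upt_rec)
  \<comment> \<open>The empty permutation does not begin with 21, so only the integral
    survives.\<close>
  have "fps_nth (E_3_21 [2, 1]) 0 = 0"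
    by (simp add: E_3_21_def N_3_21_0 begins_with_21_iff del: One_nat_def)
  then show "(\<lambda>x::real. exp (exp x) * (LBINT t=0..ereal x. exp (- exp t) * (exp t - 1)))
      has_fps_expansion E_3_21 (decreasing_pattern k)"
    using E_3_21_has_fps_expansion[OF splits_at_max_21] unfolding k by simp
next
  assume "k = 1"
  then have k: "decreasing_pattern k = [1]"
    by (simp add: decreasing_pattern_def)
  \<comment> \<open>By the convention the constant term is 1, so the integral drops out and
    \<open>exp (exp x) * exp (- 1)\<close> remains.\<close>
  have "fps_nth (E_3_21 [1]) 0 = 1"
    by (simp add: E_3_21_def N_3_21_0 begins_with_1 del: One_nat_def)
  then show "(\<lambda>x::real. exp (exp x - 1)) has_fps_expansion E_3_21 (decreasing_pattern k)"
    using E_3_21_has_fps_expansion[OF splits_at_max_1] unfolding k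
    by (simp add: exp_diff exp_minus divide_inverse)
qed

end
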